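(* Consider a two-armed Bernoulli bandit with means $0<\mu_2<\mu_1<1$. For every integer $T\ge 1$, the UCB policy has, almost surely, $$\mathrm{SliReg}(\mathrm{UCB};T)=T(\mu_1-\mu_2).$$
   Context: Two-armed Bernoulli bandit: at each time $t\ge1$ the policy picks an arm $A_t\in\{1,2\}$ from the history $(A_1,R_1,\dots,A_{t-1},R_{t-1})$, then observes $R_t\in\{0,1\}$ which, given $A_t$, is Bernoulli with mean $\mu_{A_t}$, independent of the past and of the policy's internal randomness. $N_a(t):=\sum_{i=1}^{t-1}\mathbf 1(A_i=a)$ and $\hat\mu_a(t)$ is the empirical mean of the $N_a(t)$ rewards received from arm $a$ before time $t$. UCB: at time $t$, pull an arm $A_t$ maximizing the index $\hat\mu_a(t)+\sqrt{2\log(t)/N_a(t)}$, which is $+\infty$ by convention if $N_a(t)=0$. The sliding regret is the random variable $\mathrm{SliReg}(\pi;T):=\limsup_{t\to\infty}\left(T\mu_1-\sum_{i=1}^{T}\mu_{A_{t+i}}\right)$. *)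

theory Defs
  imports "HOL-Probability.Probability"
begin

datatype arm = Arm1 | Arm2

text \<open>A reward is a bool, read as a number in {0,1} through of_bool. The history
  available at time \<open>t\<close> is the list \<open>[(A\<^sub>1, R\<^sub>1), \<dots>, (A\<^sub>t\<^sub>-\<^sub>1, R\<^sub>t\<^sub>-\<^sub>1)]\<close>, of length \<open>t - 1\<close>.\<close>

type_synonym hist = "(arm \<times> bool) list"

text \<open>The first argument of a policy is its internal randomness: a single seed, drawn
  before time 1 from an arbitrary measurable space (a sequence of fresh
  randomizations is the case of a product space).\<close>

type_synonym 'u policy = "'u \<Rightarrow> hist \<Rightarrow> arm"

definition history :: "(nat \<Rightarrow> 'a \<Rightarrow> arm) \<Rightarrow> (nat \<Rightarrow> 'a \<Rightarrow> bool) \<Rightarrow> nat \<Rightarrow> 'a \<Rightarrow> hist" where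
  "history A R t \<omega> = map (\<lambda>i. (A i \<omega>, R i \<omega>)) [1..<t]"

text \<open>The generated \<open>\<sigma>\<close>-algebra in \<open>reward_law\<close> is that of everything preceding the reward
  \<open>R\<^sub>t\<close>: the seed, the past and the current arm. As \<open>R\<^sub>t\<close> is bool-valued, its
  conditional expectation determines its conditional law. Times start at 1; the values
  of \<open>A\<close> and \<open>R\<close> at 0 play no role.\<close>

locale two_armed_bandit = prob_space M
  for M :: "'a measure" and S :: "'u measure" and U :: "'a \<Rightarrow> 'u"
    and \<mu> :: "arm \<Rightarrow> real" and \<pi> :: "'u policy"
    and A :: "nat \<Rightarrow> 'a \<Rightarrow> arm" and R :: "nat \<Rightarrow> 'a \<Rightarrow> bool" +
  assumes seed_measurable: "U \<in> M \<rightarrow>\<^sub>M S"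
    and policy_measurable: "\<And>h. (\<lambda>u. \<pi> u h) \<in> S \<rightarrow>\<^sub>M count_space UNIV"
    and arm_measurable: "\<And>t. 1 \<le> t \<Longrightarrow> A t \<in> M \<rightarrow>\<^sub>M count_space UNIV"
    and reward_measurable: "\<And>t. 1 \<le> t \<Longrightarrow> R t \<in> M \<rightarrow>\<^sub>M count_space UNIV"
    and arm_choice: "\<And>t \<omega>. 1 \<le> t \<Longrightarrow> \<omega> \<in> space M \<Longrightarrow> A t \<omega> = \<pi> (U \<omega>) (history A R t \<omega>)"
    and reward_law: "\<And>t. 1 \<le> t \<Longrightarrow>
      AE \<omega> in M. real_cond_exp M
          (vimage_algebra (space M) (\<lambda>\<omega>. (U \<omega>, history A R t \<omega>, A t \<omega>))
            (S \<Otimes>\<^sub>M count_space UNIV \<Otimes>\<^sub>M count_space UNIV))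
          (\<lambda>\<omega>. of_bool (R t \<omega>)) \<omega> = \<mu> (A t \<omega>)"

definition pulls :: "hist \<Rightarrow> arm \<Rightarrow> nat" where
  "pulls h a = length (filter (\<lambda>(b, r). b = a) h)"

definition emp_mean :: "hist \<Rightarrow> arm \<Rightarrow> real" where
  "emp_mean h a = (\<Sum>(b, r) \<leftarrow> filter (\<lambda>(b, r). b = a) h. of_bool r) / real (pulls h a)"

text \<open>The current time is \<open>length h + 1\<close>.\<close>

definition ucb_index :: "hist \<Rightarrow> arm \<Rightarrow> ereal" where
  "ucb_index h a =
    (if pulls h a = 0 then \<infinity>
     else ereal (emp_mean h a + sqrt (2 * ln (real (length h + 1)) / real (pulls h a))))"

text \<open>Ties may be broken arbitrarily, possibly at random or depending on the history.\<close>

definition is_ucb :: "'u measure \<Rightarrow> 'u policy \<Rightarrow> bool" where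
  "is_ucb S \<pi> \<longleftrightarrow> (\<forall>u \<in> space S. \<forall>h a. ucb_index h a \<le> ucb_index h (\<pi> u h))"

definition sliding_regret :: "(arm \<Rightarrow> real) \<Rightarrow> nat \<Rightarrow> (nat \<Rightarrow> arm) \<Rightarrow> ereal" where
  "sliding_regret \<mu> T \<alpha> =
    limsup (\<lambda>t. ereal (real T * \<mu> Arm1 - (\<Sum>i = 1..T. \<mu> (\<alpha> (t + i)))))"

end

theory Submission
  imports Defs "HOL-Real_Asymp.Real_Asymp"
begin

text \<open>Both arms are pulled infinitely often and the empirical means converge. So, from some time
  on, whenever arm 2 is pulled and pays 1, its index rises relative to that of arm 1, or is already
  above 1, and arm 2 is pulled again. By induction on \<open>j\<close>, a conditional Borel-Cantelli
  argument gives infinitely many runs of \<open>j\<close> consecutive rewarded pulls of arm 2. The almost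
  sure statements all come from one fact: a nonnegative supermartingale on the tree of histories
  stays bounded along almost every path.\<close>

text \<open>The obstacle is that time advances during a run of arm 2: the logarithm grows and raises
  the bonus of arm 1 as well. This does no harm. When arm 2 is pulled with the smaller empirical
  mean, its bonus is the larger one, so it has fewer pulls and profits more from the growth. For the
  same reason arm 1 then holds more than half of the pulls; its bonus is small and its index is
  eventually below 1 at such times, which uses \<open>\<mu> Arm1 < 1\<close>. The supermartingale
  inequality is imposed for each arm separately, on functions of the history. It therefore holds
  whichever arm the policy picks, and neither the seed nor the adaptive sampling times call for
  separate treatment.\<close>

instance arm :: countable
  by countable_datatype

lemma UNIV_arm: "UNIV = {Arm1, Arm2}"
  using arm.exhaust by auto

instance arm :: finite
  by standard (simp add: UNIV_arm)

section \<open>Supermartingales on the tree of histories\<close>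

definition history_supermartingale :: "(arm \<Rightarrow> real) \<Rightarrow> (hist \<Rightarrow> real) \<Rightarrow> bool" where
  "history_supermartingale \<mu> W \<longleftrightarrow> (\<forall>h. 0 \<le> W h) \<and>
     (\<forall>h a. (1 - \<mu> a) * W (h @ [(a, False)]) + \<mu> a * W (h @ [(a, True)]) \<le> W h)"

text \<open>Quantifying over prefixes makes the event that a level was hit in the past a function of
  the current history, so that stopping stays within functions of histories.\<close>

definition reaches :: "(hist \<Rightarrow> real) \<Rightarrow> real \<Rightarrow> hist \<Rightarrow> bool" where
  "reaches W C h \<longleftrightarrow> (\<exists>n\<le>length h. C \<le> W (take n h))"

lemma reaches_snoc: "reaches W C (h @ [x]) \<longleftrightarrow> reaches W C h \<or> C \<le> W (h @ [x])"
  by (auto simp: reaches_def le_Suc_eq)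

text \<open>The process is frozen at \<open>C\<close> itself, not at the value of \<open>W\<close>
  on hitting: cutting the overshoot only lowers the successors, and after the hit both sides equal
  \<open>C\<close>.\<close>

lemma history_supermartingale_stopped:
  assumes W: "history_supermartingale \<mu> W" and "0 \<le> C" and \<mu>: "\<And>a. 0 \<le> \<mu> a \<and> \<mu> a \<le> 1"
  shows "history_supermartingale \<mu> (\<lambda>h. if reaches W C h then C else W h)"
  unfolding history_supermartingale_def
proof (intro conjI allI)
  fix h show "0 \<le> (if reaches W C h then C else W h)"
    using W \<open>0 \<le> C\<close> by (simp add: history_supermartingale_def)
next
  fix h a
  let ?V = "\<lambda>h. if reaches W C h then C else W h"
  show "(1 - \<mu> a) * ?V (h @ [(a, False)]) + \<mu> a * ?V (h @ [(a, True)]) \<le> ?V h"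
  proof (cases "reaches W C h")
    case True
    then show ?thesis by (simp add: reaches_snoc algebra_simps)
  next
    case False
    have "?V (h @ [x]) \<le> W (h @ [x])" for x
      using False by (simp add: reaches_snoc)
    then have "(1 - \<mu> a) * ?V (h @ [(a, False)]) + \<mu> a * ?V (h @ [(a, True)])
        \<le> (1 - \<mu> a) * W (h @ [(a, False)]) + \<mu> a * W (h @ [(a, True)])"
      using \<mu>[of a] by (intro add_mono mult_left_mono) auto
    also have "\<dots> \<le> W h"
      using W by (simp add: history_supermartingale_def)
    finally show ?thesis using False by simp
  qed
qed

section \<open>Expectations and a maximal inequality along the bandit process\<close>

lemma history_Suc: "1 \<le> t \<Longrightarrow> history A R (Suc t) \<omega> = history A R t \<omega> @ [(A t \<omega>, R t \<omega>)]"
  by (simp add: history_def)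

lemma length_history [simp]: "length (history A R t \<omega>) = t - 1"
  by (simp add: history_def)

context two_armed_bandit
begin

lemma history_measurable:
  "history A R t \<in> M \<rightarrow>\<^sub>M count_space UNIV"
proof (induction t)
  case 0
  then show ?case by (simp add: history_def)
next
  case (Suc t)
  show ?case
  proof (cases "1 \<le> t")
    case True
    note [measurable] = Suc arm_measurable[OF True] reward_measurable[OF True]
    have "history A R (Suc t) = (\<lambda>\<omega>. history A R t \<omega> @ [(A t \<omega>, R t \<omega>)])"
      by (rule ext) (rule history_Suc[OF True])
    then show ?thesis
      by simp
  next
    case False
    then show ?thesis by (simp add: history_def)
  qed
qed

lemma integrable_history:
  fixes f :: "hist \<Rightarrow> real"
  shows "integrable M (\<lambda>\<omega>. f (history A R t \<omega>))"
proof (rule integrable_const_bound)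
  \<comment> \<open>Only finitely many histories have a given length, so every function of the
    history is bounded.\<close>
  have "finite {h :: hist. length h = t - 1}"
    using finite_lists_length_eq[of "UNIV :: (arm \<times> bool) set"] by simp
  then show "AE \<omega> in M. norm (f (history A R t \<omega>)) \<le> Max ((\<lambda>h. norm (f h)) ` {h. length h = t - 1})"
    by (intro AE_I2 Max_ge) auto
  show "(\<lambda>\<omega>. f (history A R t \<omega>)) \<in> borel_measurable M"
    by (rule measurable_compose[OF history_measurable]) simp
qed

lemma integrable_history_arm_reward:
  fixes f :: "hist \<Rightarrow> arm \<Rightarrow> bool \<Rightarrow> real"
  assumes "1 \<le> t"
  shows "integrable M (\<lambda>\<omega>. f (history A R t \<omega>) (A t \<omega>) (R t \<omega>))"
  using integrable_history[of "\<lambda>h. f (butlast h) (fst (last h)) (snd (last h))" "Suc t"]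
  by (simp add: history_Suc[OF assms])

text \<open>The only use of the reward law: \<open>g\<close> of the past and the current arm is
  measurable for the conditioning algebra, so it can be pulled out of the conditional
  expectation.\<close>

lemma integral_reward:
  fixes g :: "hist \<Rightarrow> arm \<Rightarrow> real"
  assumes "1 \<le> t"
  shows "(\<integral>\<omega>. g (history A R t \<omega>) (A t \<omega>) * of_bool (R t \<omega>) \<partial>M)
       = (\<integral>\<omega>. g (history A R t \<omega>) (A t \<omega>) * \<mu> (A t \<omega>) \<partial>M)"
proof -
  let ?X = "\<lambda>\<omega>. (U \<omega>, history A R t \<omega>, A t \<omega>)"
  let ?N = "S \<Otimes>\<^sub>M count_space (UNIV :: hist set) \<Otimes>\<^sub>M count_space (UNIV :: arm set)"
  let ?F = "vimage_algebra (space M) ?X ?N"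
  note [measurable] = seed_measurable history_measurable arm_measurable[OF assms]
    reward_measurable[OF assms]
  have X: "?X \<in> M \<rightarrow>\<^sub>M ?N"
    by measurable
  have "sets ?F \<subseteq> sets M"
    using X by (intro sets_image_in_sets) auto
  then interpret F: finite_measure_subalgebra M ?F
    by unfold_locales (auto simp: subalgebra_def)
  have XF: "?X \<in> ?F \<rightarrow>\<^sub>M ?N"
    using measurable_space[OF X] by (intro measurable_vimage_algebra1) blast
  have "(\<lambda>(u, h, a). g h a) \<in> borel_measurable ?N"
    by measurable
  from measurable_compose[OF XF this]
  have g: "(\<lambda>\<omega>. g (history A R t \<omega>) (A t \<omega>)) \<in> borel_measurable ?F"
    by simp
  have R: "(\<lambda>\<omega>. of_bool (R t \<omega>) :: real) \<in> borel_measurable M"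
    by measurable
  have int: "integrable M (\<lambda>\<omega>. g (history A R t \<omega>) (A t \<omega>) * of_bool (R t \<omega>))"
    by (rule integrable_history_arm_reward[OF assms, of "\<lambda>h a r. g h a * of_bool r"])
  have "(\<integral>\<omega>. g (history A R t \<omega>) (A t \<omega>) * of_bool (R t \<omega>) \<partial>M)
      = (\<integral>\<omega>. g (history A R t \<omega>) (A t \<omega>) *
            real_cond_exp M ?F (\<lambda>\<omega>. of_bool (R t \<omega>)) \<omega> \<partial>M)"
    using F.real_cond_exp_intg(2)[OF int g R] by simp
  also have "\<dots> = (\<integral>\<omega>. g (history A R t \<omega>) (A t \<omega>) * \<mu> (A t \<omega>) \<partial>M)"
  proof (rule integral_cong_AE)
    show "AE \<omega> in M. g (history A R t \<omega>) (A t \<omega>) * real_cond_exp M ?F (\<lambda>\<omega>. of_bool (R t \<omega>)) \<omega>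
        = g (history A R t \<omega>) (A t \<omega>) * \<mu> (A t \<omega>)"
      using reward_law[OF assms] by eventually_elim simp
    show "(\<lambda>\<omega>. g (history A R t \<omega>) (A t \<omega>) * real_cond_exp M ?F (\<lambda>\<omega>. of_bool (R t \<omega>)) \<omega>)
        \<in> borel_measurable M"
      using F.real_cond_exp_intg(1)[OF int g R] by (rule borel_measurable_integrable)
    show "(\<lambda>\<omega>. g (history A R t \<omega>) (A t \<omega>) * \<mu> (A t \<omega>)) \<in> borel_measurable M"
      by (rule borel_measurable_integrable,
          rule integrable_history_arm_reward[OF assms, of "\<lambda>h a r. g h a * \<mu> a"])
  qed
  finally show ?thesis .
qed

lemma expectation_supermartingale_le:
  assumes W: "history_supermartingale \<mu> W" and "1 \<le> t"
  shows "expectation (\<lambda>\<omega>. W (history A R t \<omega>)) \<le> W []"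
  using \<open>1 \<le> t\<close>
proof (induction t rule: dec_induct)
  case base
  then show ?case by (simp add: history_def prob_space)
next
  case (step t)
  \<comment> \<open>A function of a Bernoulli variable is affine in it:
    \<open>W (h @ [(a, r)])\<close> is its value at \<open>False\<close> plus \<open>D h a\<close>
    times the reward, which is the form that \<open>integral_reward\<close> handles.\<close>
  define D where "D h a = W (h @ [(a, True)]) - W (h @ [(a, False)])" for h a
  note int = integrable_history_arm_reward[OF \<open>1 \<le> t\<close>]
  have "expectation (\<lambda>\<omega>. W (history A R (Suc t) \<omega>))
      = expectation (\<lambda>\<omega>. W (history A R t \<omega> @ [(A t \<omega>, False)]) +
          D (history A R t \<omega>) (A t \<omega>) * of_bool (R t \<omega>))"
    by (intro Bochner_Integration.integral_cong refl)
       (auto simp: history_Suc[OF \<open>1 \<le> t\<close>] D_def of_bool_def)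
  also have "\<dots> = expectation (\<lambda>\<omega>. W (history A R t \<omega> @ [(A t \<omega>, False)])) +
      expectation (\<lambda>\<omega>. D (history A R t \<omega>) (A t \<omega>) * \<mu> (A t \<omega>))"
    using int[of "\<lambda>h a r. W (h @ [(a, False)])"] int[of "\<lambda>h a r. D h a * of_bool r"]
      integral_reward[OF \<open>1 \<le> t\<close>, of D] by simp
  also have "\<dots> = expectation (\<lambda>\<omega>. W (history A R t \<omega> @ [(A t \<omega>, False)]) +
      D (history A R t \<omega>) (A t \<omega>) * \<mu> (A t \<omega>))"
    using int[of "\<lambda>h a r. W (h @ [(a, False)])"] int[of "\<lambda>h a r. D h a * \<mu> a"] by simp
  also have "\<dots> \<le> expectation (\<lambda>\<omega>. W (history A R t \<omega>))"
  proof (rule integral_mono)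
    show "integrable M (\<lambda>\<omega>. W (history A R t \<omega> @ [(A t \<omega>, False)]) +
      D (history A R t \<omega>) (A t \<omega>) * \<mu> (A t \<omega>))"
      by (rule int[of "\<lambda>h a r. W (h @ [(a, False)]) + D h a * \<mu> a"])
    fix \<omega>
    have "(1 - \<mu> a) * W (h @ [(a, False)]) + \<mu> a * W (h @ [(a, True)]) \<le> W h" for h a
      using W by (simp add: history_supermartingale_def)
    from this[of "A t \<omega>" "history A R t \<omega>"]
    show "W (history A R t \<omega> @ [(A t \<omega>, False)]) +
      D (history A R t \<omega>) (A t \<omega>) * \<mu> (A t \<omega>) \<le> W (history A R t \<omega>)"
      by (simp add: D_def algebra_simps)
  qed (rule integrable_history)
  finally show ?case using step.IH by simp
qed

text \<open>Ville's maximal inequality, by Markov's inequality for the stopped process.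
  \<open>W [] < C\<close> ensures that the process is not already stopped at the empty
  history.\<close>

lemma prob_reaches_le:
  assumes W: "history_supermartingale \<mu> W" and \<mu>: "\<And>a. 0 \<le> \<mu> a \<and> \<mu> a \<le> 1"
    and "0 < C" and "W [] < C" and "1 \<le> t"
  shows "prob {\<omega> \<in> space M. reaches W C (history A R t \<omega>)} \<le> W [] / C"
proof -
  let ?V = "\<lambda>h. if reaches W C h then C else W h"
  have V: "history_supermartingale \<mu> ?V"
    using W \<open>0 < C\<close> \<mu> by (intro history_supermartingale_stopped) auto
  have "C * prob {\<omega> \<in> space M. C \<le> ?V (history A R t \<omega>)} \<le> expectation (\<lambda>\<omega>. ?V (history A R t \<omega>))"
    using integral_Markov_inequality_measure[of M "\<lambda>\<omega>. ?V (history A R t \<omega>)" "{}" C]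
      integrable_history[of ?V t] V \<open>0 < C\<close>
    by (simp add: history_supermartingale_def field_simps)
  also have "\<dots> \<le> ?V []"
    using V \<open>1 \<le> t\<close> by (rule expectation_supermartingale_le)
  also have "\<dots> = W []"
    using \<open>W [] < C\<close> by (simp add: reaches_def)
  also have "{\<omega> \<in> space M. C \<le> ?V (history A R t \<omega>)} = {\<omega> \<in> space M. reaches W C (history A R t \<omega>)}"
    by (auto simp: reaches_def dest: spec[of _ "t - 1"])
  finally show ?thesis
    using \<open>0 < C\<close> by (simp add: field_simps)
qed

text \<open>A path on which \<open>W\<close> is unbounded reaches every level \<open>C\<close>,
  which has probability at most \<open>W [] / C\<close> for all large \<open>C\<close>.\<close>

lemma AE_supermartingale_bounded:
  assumes W: "history_supermartingale \<mu> W" and \<mu>: "\<And>a. 0 \<le> \<mu> a \<and> \<mu> a \<le> 1"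
  shows "AE \<omega> in M. \<exists>C. \<forall>t\<ge>1. W (history A R t \<omega>) \<le> C"
proof -
  define B where "B C t = {\<omega> \<in> space M. reaches W C (history A R (Suc t) \<omega>)}" for C t
  have B_events: "B C t \<in> events" for C t
    unfolding B_def using measurable_sets[OF history_measurable, of "{h. reaches W C h}" "Suc t"]
    by (simp add: vimage_def Int_def conj_commute)
  have "incseq (B C)" for C
    by (auto simp: incseq_Suc_iff B_def history_Suc[where t = "Suc t" for t] reaches_snoc)
  then have lim: "(\<lambda>t. prob (B C t)) \<longlonglongrightarrow> prob (\<Union>t. B C t)" for C
    using B_events by (intro finite_Lim_measure_incseq) auto
  have bound: "prob (\<Union>t. B C t) \<le> W [] / C" if "0 < C" "W [] < C" for C
    using that by (intro LIMSEQ_le_const2[OF lim]) (auto simp: B_def intro!: prob_reaches_le[OF W \<mu>])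
  define N where "N = (\<Inter>C::nat. \<Union>t. B (real C) t)"
  have N: "N \<in> events"
    unfolding N_def using B_events by (intro sets.countable_INT sets.countable_UN) auto
  have "prob N \<le> W [] / real C" if "W [] < real C" "0 < C" for C :: nat
  proof -
    have "prob N \<le> prob (\<Union>t. B (real C) t)"
      using B_events by (intro finite_measure_mono) (auto simp: N_def)
    also have "\<dots> \<le> W [] / real C"
      using that by (intro bound) auto
    finally show ?thesis .
  qed
  moreover have "eventually (\<lambda>C. W [] < real C \<and> 0 < C) sequentially"
    using eventually_conj[OF filterlim_real_sequentially[THEN filterlim_at_top_dense[THEN iffD1], rule_format]
      eventually_gt_at_top[of 0]] .
  moreover have "(\<lambda>C. W [] / real C) \<longlonglongrightarrow> 0"
    by (rule lim_const_over_n)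
  ultimately have "prob N \<le> 0"
    by (intro tendsto_lowerbound[of _ _ sequentially]) (auto elim: eventually_mono)
  then have "prob N = 0"
    using measure_nonneg[of M N] by linarith
  then have "AE \<omega> in M. \<omega> \<notin> N"
    using N by (subst (asm) prob_eq_0) auto
  then show ?thesis
  proof (rule AE_mp, intro AE_I2 impI)
    fix \<omega> assume "\<omega> \<in> space M" "\<omega> \<notin> N"
    then obtain C :: nat where C: "\<And>t. \<not> reaches W C (history A R (Suc t) \<omega>)"
      by (auto simp: N_def B_def)
    have "W (history A R t \<omega>) \<le> C" if "1 \<le> t" for t
      using C[of "t - 1"] that by (auto simp: reaches_def dest: spec[of _ "t - 1"])
    then show "\<exists>C. \<forall>t\<ge>1. W (history A R t \<omega>) \<le> C"
      by blast
  qed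
qed

end

section \<open>Empirical means and deterministic properties of UCB\<close>

text \<open>Unlike the mean, this numerator changes additively when a pull is appended.\<close>

definition reward_sum :: "hist \<Rightarrow> arm \<Rightarrow> real" where
  "reward_sum h a = (\<Sum>(b, r) \<leftarrow> filter (\<lambda>(b, r). b = a) h. of_bool r)"

lemma pulls_Nil [simp]: "pulls [] a = 0"
  by (simp add: pulls_def)

lemma pulls_snoc [simp]: "pulls (h @ [(b, r)]) a = pulls h a + of_bool (b = a)"
  by (simp add: pulls_def)

lemma reward_sum_Nil [simp]: "reward_sum [] a = 0"
  by (simp add: reward_sum_def)

lemma reward_sum_snoc [simp]:
  "reward_sum (h @ [(b, r)]) a = reward_sum h a + of_bool (b = a \<and> r)"
  by (simp add: reward_sum_def)

lemma reward_sum_bounds: "0 \<le> reward_sum h a \<and> reward_sum h a \<le> real (pulls h a)"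
proof (induction h rule: rev_induct)
  case (snoc x h)
  then show ?case by (cases x) auto
qed simp

lemma emp_mean_eq: "emp_mean h a = reward_sum h a / real (pulls h a)"
  by (simp add: emp_mean_def reward_sum_def)

lemma emp_mean_bounds: "0 \<le> emp_mean h a" "emp_mean h a \<le> 1"
  using reward_sum_bounds[of h a] by (auto simp: emp_mean_eq divide_le_eq_1)

text \<open>With no pulls both sides vanish, since the sum is bounded by the number of
  pulls.\<close>

lemma pulls_times_emp_mean: "real (pulls h a) * emp_mean h a = reward_sum h a"
  using reward_sum_bounds[of h a] by (auto simp: emp_mean_eq)

lemma pulls_add: "a \<noteq> b \<Longrightarrow> pulls h a + pulls h b = length h"
proof (induction h rule: rev_induct)
  case (snoc x h)
  then show ?case by (cases x; cases "fst x"; cases a; cases b) auto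
qed simp

lemma pulls_history_mono:
  assumes "s \<le> t"
  shows "pulls (history A R s \<omega>) a \<le> pulls (history A R t \<omega>) a"
  using assms
proof (induction t rule: dec_induct)
  case (step t)
  then show ?case
    by (cases "t = 0") (auto simp: history_Suc history_def)
qed simp

lemma filterlim_pulls:
  assumes "\<exists>\<^sub>F t in sequentially. A t \<omega> = a"
  shows "filterlim (\<lambda>t. pulls (history A R t \<omega>) a) at_top sequentially"
  unfolding filterlim_at_top
proof
  fix n show "\<forall>\<^sub>F t in sequentially. n \<le> pulls (history A R t \<omega>) a"
  proof (induction n)
    case (Suc n)
    have "\<exists>\<^sub>F t in sequentially. A t \<omega> = a \<and> (n \<le> pulls (history A R t \<omega>) a \<and> 1 \<le> t)"
      using assms eventually_conj[OF Suc eventually_ge_at_top[of "1::nat"]]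
      by (rule frequently_eventually_frequently)
    then obtain t where "A t \<omega> = a" "n \<le> pulls (history A R t \<omega>) a" "1 \<le> t"
      by (auto dest!: frequently_ex)
    then have "Suc n \<le> pulls (history A R (Suc t) \<omega>) a"
      by (simp add: history_Suc)
    then show ?case
      unfolding eventually_sequentially
      by (meson order_trans pulls_history_mono)
  qed simp
qed

text \<open>An arm abandoned after some time would have an index growing like \<open>sqrt (ln t)\<close>, while
  the index of the other one stays bounded.\<close>
lemma ucb_frequently_pulls:
  assumes ucb: "\<And>t a. 1 \<le> t \<Longrightarrow>
    ucb_index (history A R t \<omega>) a \<le> ucb_index (history A R t \<omega>) (A t \<omega>)"
  shows "\<exists>\<^sub>F t in sequentially. A t \<omega> = a"
proof (rule ccontr)
  let ?H = "\<lambda>t. history A R t \<omega>"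
  assume "\<not> (\<exists>\<^sub>F t in sequentially. A t \<omega> = a)"
  then have "\<forall>\<^sub>F t in sequentially. A t \<omega> \<noteq> a \<and> 1 \<le> t"
    using eventually_ge_at_top[of "1::nat"] by (simp add: not_frequently eventually_conj)
  then obtain m where m: "\<And>t. m \<le> t \<Longrightarrow> A t \<omega> \<noteq> a" and "1 \<le> m"
    by (auto simp: eventually_sequentially)
  define b where "b = A m \<omega>"
  have b: "A t \<omega> = b" if "m \<le> t" for t
    using m[OF that] m[OF order_refl] unfolding b_def
    by (cases "A t \<omega>"; cases a; cases "A m \<omega>") auto
  have "b \<noteq> a"
    using m[of m] by (simp add: b_def)
  define k where "k = pulls (?H m) a"
  have pa: "pulls (?H t) a = k" if "m \<le> t" for t
    using that
  proof (induction t rule: dec_induct)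
    case (step t)
    then show ?case using m[of t] \<open>1 \<le> m\<close> by (simp add: history_Suc)
  qed (simp add: k_def)
  have pb: "pulls (?H t) b = t - 1 - k" if "m \<le> t" for t
    using pulls_add[OF \<open>b \<noteq> a\<close>, of "?H t"] pa[OF that] by simp
  have pb_pos: "0 < pulls (?H t) b" if "m < t" for t
  proof -
    have "0 < pulls (?H (Suc m)) b"
      using \<open>1 \<le> m\<close> by (simp add: history_Suc b_def)
    also have "\<dots> \<le> pulls (?H t) b"
      using that by (intro pulls_history_mono) simp
    finally show ?thesis .
  qed
  have le: "ucb_index (?H t) a \<le> ucb_index (?H t) b" if "m < t" for t
    using ucb[of t a] b[of t] that by simp
  \<comment> \<open>An arm never pulled would have index \<infinity>, whereas \<open>b\<close> has a
    finite index after time \<open>m\<close>.\<close>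
  have "0 < k"
    using le[of "Suc m"] pa[of "Suc m"] pb_pos[of "Suc m"]
    by (cases "k = 0") (auto simp: ucb_index_def)
  \<comment> \<open>The empirical means lie in [0, 1], so the bonuses can differ by at most 1 in
    favour of \<open>a\<close>; with \<open>k\<close> fixed this difference diverges.\<close>
  have "sqrt (2 * ln (real t) / real k) - sqrt (2 * ln (real t) / (real t - 1 - real k)) \<le> 1"
    if "m < t" for t
  proof -
    have idx: "emp_mean (?H t) a + sqrt (2 * ln (real t) / real k)
        \<le> emp_mean (?H t) b + sqrt (2 * ln (real t) / real (t - 1 - k))"
      using le[OF that] pb_pos[OF that] pa[of t] pb[of t] that \<open>0 < k\<close>
      by (simp add: ucb_index_def)
    have diff: "real (t - 1 - k) = real t - 1 - real k"
      using pb_pos[OF that] pb[of t] that by simp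
    show ?thesis
      using idx[unfolded diff] emp_mean_bounds(1)[of "?H t" a] emp_mean_bounds(2)[of "?H t" b] by linarith
  qed
  then have "\<forall>\<^sub>F t in sequentially.
      sqrt (2 * ln (real t) / real k) - sqrt (2 * ln (real t) / (real t - 1 - real k)) \<le> 1"
    by (intro eventually_mono[OF eventually_gt_at_top[of m]])
  moreover have "filterlim (\<lambda>t. sqrt (2 * ln (real t) / real k)
      - sqrt (2 * ln (real t) / (real t - 1 - real k))) at_top sequentially"
    using \<open>0 < k\<close> by real_asymp
  then have "\<forall>\<^sub>F t in sequentially.
      1 < sqrt (2 * ln (real t) / real k) - sqrt (2 * ln (real t) / (real t - 1 - real k))"
    by (simp add: filterlim_at_top_dense)
  ultimately have "\<forall>\<^sub>F t :: nat in sequentially. False"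
    by eventually_elim simp
  then show False by simp
qed

text \<open>With \<open>b = sqrt (2 L' / n)\<close> and \<open>x = sqrt (n / (n + 1))\<close>, a reward 1 raises the mean by
  \<open>(1 - s) (1 - x\<^sup>2)\<close> and lowers the bonus by \<open>b (1 - x)\<close>. If the latter is not
  smaller than the former, then \<open>b \<ge> (1 - s) (1 + x)\<close> and the new index is at least 1.\<close>
lemma ucb_gain_of_reward:
  fixes n N L L' s s1 :: real
  assumes "0 < n" "0 < N" "0 \<le> L" "L \<le> L'" "s < s1"
    and le: "s1 + sqrt (2 * L / N) \<le> s + sqrt (2 * L / n)"
    and lt: "s1 + sqrt (2 * L' / N) < 1"
  shows "s1 + sqrt (2 * L' / N) < (n * s + 1) / (n + 1) + sqrt (2 * L' / (n + 1))"
proof -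
  have sqrt_div: "sqrt (2 * K / y) = sqrt (2 * K) * (1 / sqrt y)" for K y
    by (simp add: real_sqrt_divide)
  \<comment> \<open>The arm with the smaller mean has the larger bonus, hence the larger factor
    \<open>1 / sqrt n\<close>. Replacing \<open>L\<close> by \<open>L'\<close> thus raises its bonus
    at least as much, and the comparison \<open>le\<close> survives the passage of time.\<close>
  have "0 < sqrt (2 * L) * (1 / sqrt n - 1 / sqrt N)"
    using le \<open>s < s1\<close> by (simp only: sqrt_div right_diff_distrib)
  then have "0 \<le> 1 / sqrt n - 1 / sqrt N"
    using \<open>0 \<le> L\<close> by (simp add: zero_less_mult_iff)
  then have "sqrt (2 * L) * (1 / sqrt n - 1 / sqrt N) \<le> sqrt (2 * L') * (1 / sqrt n - 1 / sqrt N)"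
    using \<open>L \<le> L'\<close> by (intro mult_right_mono) auto
  then have le': "s1 + sqrt (2 * L' / N) \<le> s + sqrt (2 * L' / n)"
    using le by (simp only: sqrt_div right_diff_distrib)
  define b x where "b = sqrt (2 * L' / n)" and "x = sqrt (n / (n + 1))"
  have x: "0 \<le> x" "x < 1" and x2: "x\<^sup>2 = n / (n + 1)"
    using \<open>0 < n\<close> by (auto simp: x_def)
  have bx: "sqrt (2 * L' / (n + 1)) = b * x"
    using \<open>0 < n\<close> by (simp add: b_def x_def flip: real_sqrt_mult)
  have mean: "(n * s + 1) / (n + 1) = s + (1 - s) * (1 - x\<^sup>2)"
    using \<open>0 < n\<close> by (simp add: x2 field_simps)
  have "0 \<le> sqrt (2 * L' / N)"
    using assms by auto
  then have "s < 1"
    using lt \<open>s < s1\<close> by linarith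
  show ?thesis
  proof (cases "b < (1 - s) * (1 + x)")
    case True
    then have "b * (1 - x) < (1 - s) * (1 + x) * (1 - x)"
      using x by (intro mult_strict_right_mono) auto
    then have "s + b < s + (1 - s) * (1 - x\<^sup>2) + b * x"
      by (simp add: algebra_simps power2_eq_square)
    then show ?thesis
      using le' by (simp add: mean bx b_def)
  next
    case False
    then have "(1 - s) * (1 + x) * x \<le> b * x"
      using x by (intro mult_right_mono) auto
    moreover have "0 \<le> (1 - s) * x"
      using x \<open>s < 1\<close> by simp
    ultimately have "1 \<le> s + (1 - s) * (1 - x\<^sup>2) + b * x"
      by (simp add: algebra_simps power2_eq_square)
    then show ?thesis
      using lt by (simp add: mean bx)
  qed
qed

lemma ucb_repeats_rewarded_arm:
  assumes ucb: "\<And>t a. 1 \<le> t \<Longrightarrow>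
      ucb_index (history A R t \<omega>) a \<le> ucb_index (history A R t \<omega>) (A t \<omega>)"
    and less: "\<forall>\<^sub>F t in sequentially. emp_mean (history A R t \<omega>) Arm2 < emp_mean (history A R t \<omega>) Arm1"
    and bound: "\<forall>\<^sub>F t in sequentially. emp_mean (history A R t \<omega>) Arm1 < d" and "d < 1"
  shows "\<forall>\<^sub>F t in sequentially. A t \<omega> = Arm2 \<longrightarrow> R t \<omega> \<longrightarrow> A (Suc t) \<omega> = Arm2"
proof -
  let ?H = "\<lambda>t. history A R t \<omega>"
  have "\<exists>\<^sub>F t in sequentially. A t \<omega> = a" for a
    by (rule ucb_frequently_pulls[where R = R]) (rule ucb)
  then have pos: "\<forall>\<^sub>F t in sequentially. 0 < pulls (?H t) a" for a
    using filterlim_pulls[of A \<omega> a R] by (auto simp: filterlim_at_top Suc_le_eq dest: spec[of _ 1])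
  \<comment> \<open>The \<open>t - 1\<close> past pulls are shared by two arms, and arm 1 will turn
    out to have more than half of them. The logarithm is taken at the next time,
    \<open>t + 1\<close>.\<close>
  have "(\<lambda>t. sqrt (2 * ln (real t + 1) / ((real t - 1) / 2))) \<longlonglongrightarrow> 0"
    by real_asymp
  then have small: "\<forall>\<^sub>F t in sequentially. sqrt (2 * ln (real t + 1) / ((real t - 1) / 2)) < 1 - d"
    using \<open>d < 1\<close> by (intro order_tendstoD) auto
  show ?thesis
    using less bound small pos[of Arm1] pos[of Arm2] eventually_gt_at_top[of 1]
  proof eventually_elim
    case (elim t)
    define n N s s1 where "n = real (pulls (?H t) Arm2)" and "N = real (pulls (?H t) Arm1)"
      and "s = emp_mean (?H t) Arm2" and "s1 = emp_mean (?H t) Arm1"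
    have nN: "0 < n" "0 < N" "n + N = real t - 1"
      using elim pulls_add[of Arm1 Arm2 "?H t"] by (auto simp: n_def N_def)
    show ?case
    proof (intro impI)
      assume A: "A t \<omega> = Arm2" and R: "R t \<omega>"
      have le: "s1 + sqrt (2 * ln (real t) / N) \<le> s + sqrt (2 * ln (real t) / n)"
        using ucb[of t Arm1] A elim by (simp add: ucb_index_def n_def N_def s_def s1_def)
      moreover have "s < s1"
        using elim by (simp add: s_def s1_def)
      ultimately have "sqrt (2 * ln (real t) / N) < sqrt (2 * ln (real t) / n)"
        by linarith
      then have "2 * ln (real t) / N < 2 * ln (real t) / n"
        by (simp only: real_sqrt_less_iff)
      then have "n < N"
        using nN elim by (simp add: field_simps)
      then have "sqrt (2 * ln (real t + 1) / N) \<le> sqrt (2 * ln (real t + 1) / ((real t - 1) / 2))"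
        using nN elim by (intro real_sqrt_le_mono divide_left_mono mult_pos_pos) auto
      then have lt: "s1 + sqrt (2 * ln (real t + 1) / N) < 1"
        using elim(2,3) unfolding s1_def by linarith
      have "s1 + sqrt (2 * ln (real t + 1) / N)
          < (n * s + 1) / (n + 1) + sqrt (2 * ln (real t + 1) / (n + 1))"
        using nN elim by (intro ucb_gain_of_reward[OF _ _ _ _ _ le lt]) (auto simp: s_def s1_def)
      moreover have "ucb_index (?H (Suc t)) Arm1 = s1 + sqrt (2 * ln (real t + 1) / N)"
        using elim A R by (simp add: history_Suc ucb_index_def s1_def N_def emp_mean_eq add.commute)
      moreover have "ucb_index (?H (Suc t)) Arm2
          = (n * s + 1) / (n + 1) + sqrt (2 * ln (real t + 1) / (n + 1))"
        using elim A R
        by (simp add: history_Suc ucb_index_def s_def n_def pulls_times_emp_mean add.commute)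
           (simp add: emp_mean_eq add.commute)
      \<comment> \<open>The strict inequality forces the choice under any tie-breaking.\<close>
      ultimately have "ucb_index (?H (Suc t)) Arm1 < ucb_index (?H (Suc t)) Arm2"
        by simp
      then show "A (Suc t) \<omega> = Arm2"
        using ucb[of "Suc t" Arm2] by (cases "A (Suc t) \<omega>") auto
    qed
  qed
qed

section \<open>Almost sure limits along the bandit process\<close>

text \<open>Hoeffding's lemma for a centred Bernoulli variable. A negative \<open>c\<close> is
  reduced to a positive one by exchanging the two outcomes.\<close>

lemma exp_weight_le_1:
  fixes p c :: real
  assumes "0 \<le> p" "p \<le> 1"
  shows "(1 - p) * exp (- c * p - c\<^sup>2 / 8) + p * exp (c * (1 - p) - c\<^sup>2 / 8) \<le> 1"
proof -
  have *: "(1 - q) * exp (- l * q) + q * exp (l * (1 - q)) \<le> exp (l\<^sup>2 / 8)"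
    if "0 \<le> l" "0 \<le> q" "q \<le> 1" for l q :: real
  proof -
    have pos: "0 < 1 + q * (exp l - 1)"
      using that by (intro add_pos_nonneg mult_nonneg_nonneg) auto
    have "(1 - q) * exp (- l * q) + q * exp (l * (1 - q)) = exp (- l * q) * (1 + q * (exp l - 1))"
      by (simp add: algebra_simps flip: exp_add)
    also have "\<dots> = exp (- l * q + ln (1 + q * (exp l - 1)))"
      using pos by (simp only: exp_add exp_ln)
    also have "\<dots> \<le> exp (l\<^sup>2 / 8)"
      using Hoeffdings_lemma_aux[of l q] that by simp
    finally show ?thesis .
  qed
  have "(1 - p) * exp (- c * p) + p * exp (c * (1 - p)) \<le> exp (c\<^sup>2 / 8)"
  proof (cases "0 \<le> c")
    case True
    then show ?thesis using *[of c p] assms by simp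
  next
    case False
    then show ?thesis using *[of "- c" "1 - p"] assms by (simp add: algebra_simps)
  qed
  then have "((1 - p) * exp (- c * p) + p * exp (c * (1 - p))) / exp (c\<^sup>2 / 8) \<le> 1"
    by simp
  then show ?thesis
    by (simp add: exp_diff add_divide_distrib)
qed

text \<open>Its clock is the number of pulls of \<open>a\<close>: pulls of the other arm leave the
  value unchanged.\<close>

lemma history_supermartingale_exp:
  assumes "0 \<le> \<mu> a" "\<mu> a \<le> 1"
  shows "history_supermartingale \<mu>
    (\<lambda>h. exp (c * (reward_sum h a - \<mu> a * real (pulls h a)) - c\<^sup>2 / 8 * real (pulls h a)))"
    (is "history_supermartingale \<mu> ?W")
  unfolding history_supermartingale_def
proof (intro conjI allI)
  fix h b
  show "(1 - \<mu> b) * ?W (h @ [(b, False)]) + \<mu> b * ?W (h @ [(b, True)]) \<le> ?W h"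
  proof (cases "b = a")
    case True
    have "?W (h @ [(a, False)]) = ?W h * exp (- c * \<mu> a - c\<^sup>2 / 8)"
      and "?W (h @ [(a, True)]) = ?W h * exp (c * (1 - \<mu> a) - c\<^sup>2 / 8)"
      by (simp_all add: algebra_simps flip: exp_add)
    then have "(1 - \<mu> a) * ?W (h @ [(a, False)]) + \<mu> a * ?W (h @ [(a, True)])
        = ?W h * ((1 - \<mu> a) * exp (- c * \<mu> a - c\<^sup>2 / 8) + \<mu> a * exp (c * (1 - \<mu> a) - c\<^sup>2 / 8))"
      by (simp only: algebra_simps)
    also have "\<dots> \<le> ?W h * 1"
      using exp_weight_le_1[OF assms] by (intro mult_left_mono) auto
    finally show ?thesis using True by simp
  qed (simp add: algebra_simps)
qed simp

text \<open>The fortune of a gambler who stakes everything, at fair odds, on reward 0 at each pull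
  of \<open>a\<close> made under \<open>\<Gamma>\<close>. Position \<open>i\<close> of the list is
  time \<open>i + 1\<close>, so betting starts at time \<open>m + 1\<close>.\<close>

definition waiting_weight :: "(arm \<Rightarrow> real) \<Rightarrow> (hist \<Rightarrow> bool) \<Rightarrow> arm \<Rightarrow> nat \<Rightarrow> hist \<Rightarrow> real" where
  "waiting_weight \<mu> \<Gamma> a m h = (\<Prod>i<length h.
     if m \<le> i \<and> \<Gamma> (take i h) \<and> fst (h ! i) = a then (if snd (h ! i) then 0 else 1 / (1 - \<mu> a)) else 1)"

lemma waiting_weight_Nil [simp]: "waiting_weight \<mu> \<Gamma> a m [] = 1"
  by (simp add: waiting_weight_def)

lemma waiting_weight_snoc:
  "waiting_weight \<mu> \<Gamma> a m (h @ [(b, r)]) = waiting_weight \<mu> \<Gamma> a m h *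
     (if m \<le> length h \<and> \<Gamma> h \<and> b = a then (if r then 0 else 1 / (1 - \<mu> a)) else 1)"
proof -
  have "(\<Prod>i<length h. if m \<le> i \<and> \<Gamma> (take i (h @ [(b, r)])) \<and> fst ((h @ [(b, r)]) ! i) = a
      then (if snd ((h @ [(b, r)]) ! i) then 0 else 1 / (1 - \<mu> a)) else 1)
    = waiting_weight \<mu> \<Gamma> a m h"
    unfolding waiting_weight_def by (intro prod.cong) (auto simp: nth_append)
  then show ?thesis
    by (simp add: waiting_weight_def[of _ _ _ _ "h @ [(b, r)]"])
qed

lemma history_supermartingale_waiting:
  assumes "\<mu> a < 1"
  shows "history_supermartingale \<mu> (waiting_weight \<mu> \<Gamma> a m)"
  unfolding history_supermartingale_def
proof (intro conjI allI)
  fix h show "0 \<le> waiting_weight \<mu> \<Gamma> a m h"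
    using assms unfolding waiting_weight_def by (intro prod_nonneg) auto
next
  fix h b
  show "(1 - \<mu> b) * waiting_weight \<mu> \<Gamma> a m (h @ [(b, False)]) +
      \<mu> b * waiting_weight \<mu> \<Gamma> a m (h @ [(b, True)]) \<le> waiting_weight \<mu> \<Gamma> a m h"
    using assms by (simp add: waiting_weight_snoc) (simp add: algebra_simps)
qed

context two_armed_bandit
begin

text \<open>The sign of \<epsilon> selects the side of the deviation. The tilt
  \<open>c = 4 * \<epsilon>\<close> maximizes \<open>c * \<epsilon> - c\<^sup>2 / 8\<close>, with
  value \<open>2 * \<epsilon>\<^sup>2\<close>: a deviation of at least \<epsilon> would push the
  weight to \<open>exp (2 * \<epsilon>\<^sup>2 * n)\<close> after \<open>n\<close> pulls, against
  its boundedness.\<close>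

lemma AE_eventually_emp_mean:
  assumes \<mu>: "\<And>a. 0 \<le> \<mu> a \<and> \<mu> a \<le> 1" and "\<epsilon> \<noteq> 0"
  shows "AE \<omega> in M. (\<exists>\<^sub>F t in sequentially. A t \<omega> = a) \<longrightarrow>
    (\<forall>\<^sub>F t in sequentially. \<epsilon> * (emp_mean (history A R t \<omega>) a - \<mu> a) < \<epsilon>\<^sup>2)"
proof -
  let ?p = "\<lambda>t \<omega>. real (pulls (history A R t \<omega>) a)"
  let ?W = "\<lambda>h. exp (4 * \<epsilon> * (reward_sum h a - \<mu> a * real (pulls h a)) -
    (4 * \<epsilon>)\<^sup>2 / 8 * real (pulls h a))"
  have "AE \<omega> in M. \<exists>C. \<forall>t\<ge>1. ?W (history A R t \<omega>) \<le> C"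
    using \<mu> by (intro AE_supermartingale_bounded history_supermartingale_exp) auto
  then show ?thesis
  proof (eventually_elim, intro impI)
    fix \<omega>
    let ?H = "\<lambda>t. history A R t \<omega>"
    assume "\<exists>C. \<forall>t\<ge>1. ?W (?H t) \<le> C" and freq: "\<exists>\<^sub>F t in sequentially. A t \<omega> = a"
    then obtain C where C: "\<And>t. 1 \<le> t \<Longrightarrow> ?W (?H t) \<le> C"
      by blast
    have "filterlim (\<lambda>t. ?p t \<omega>) at_top sequentially"
      using filterlim_compose[OF filterlim_real_sequentially filterlim_pulls[of A \<omega> a R]] freq by simp
    then have "filterlim (\<lambda>t. 2 * \<epsilon>\<^sup>2 * ?p t \<omega>) at_top sequentially"
      using \<open>\<epsilon> \<noteq> 0\<close> by (intro filterlim_tendsto_pos_mult_at_top[OF tendsto_const]) auto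
    then have "filterlim (\<lambda>t. exp (2 * \<epsilon>\<^sup>2 * ?p t \<omega>)) at_top sequentially"
      by (rule filterlim_compose[OF exp_at_top])
    then have "\<forall>\<^sub>F t in sequentially. C < exp (2 * \<epsilon>\<^sup>2 * ?p t \<omega>)"
      by (simp add: filterlim_at_top_dense)
    then show "\<forall>\<^sub>F t in sequentially. \<epsilon> * (emp_mean (?H t) a - \<mu> a) < \<epsilon>\<^sup>2"
      using eventually_ge_at_top[of 1]
    proof eventually_elim
      case (elim t)
      have "exp (?p t \<omega> * (4 * (\<epsilon> * (emp_mean (?H t) a - \<mu> a)) - 2 * \<epsilon>\<^sup>2)) = ?W (?H t)"
        by (simp add: algebra_simps power2_eq_square flip: pulls_times_emp_mean)
      also have "\<dots> < exp (2 * \<epsilon>\<^sup>2 * ?p t \<omega>)"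
        using C[of t] elim by linarith
      finally have lt: "?p t \<omega> * (4 * (\<epsilon> * (emp_mean (?H t) a - \<mu> a)) - 2 * \<epsilon>\<^sup>2) < ?p t \<omega> * (2 * \<epsilon>\<^sup>2)"
        by (simp add: mult.commute)
      show ?case
        using mult_left_less_imp_less[OF lt] by simp
    qed
  qed
qed

text \<open>A conditional Borel-Cantelli statement: were no reward received at the times in question
  after some point, each of them would multiply the waiting weight by \<open>1 / (1 - \<mu> a)\<close>.\<close>
lemma AE_frequently_rewarded:
  assumes \<mu>: "\<And>a. 0 < \<mu> a \<and> \<mu> a < 1"
  shows "AE \<omega> in M. (\<exists>\<^sub>F t in sequentially. \<Gamma> (history A R t \<omega>) \<and> A t \<omega> = a) \<longrightarrow>
    (\<exists>\<^sub>F t in sequentially. \<Gamma> (history A R t \<omega>) \<and> A t \<omega> = a \<and> R t \<omega>)"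
proof -
  let ?W = "waiting_weight \<mu> \<Gamma> a"
  \<comment> \<open>The last rewarded time depends on \<omega>, so all starting points
    \<open>m\<close> are treated on one almost sure event.\<close>
  have "AE \<omega> in M. \<forall>m. \<exists>C. \<forall>t\<ge>1. ?W m (history A R t \<omega>) \<le> C"
    unfolding AE_all_countable
    using \<mu> by (intro allI AE_supermartingale_bounded history_supermartingale_waiting) (auto simp: less_imp_le)
  then show ?thesis
  proof (eventually_elim, intro impI)
    fix \<omega>
    let ?H = "\<lambda>t. history A R t \<omega>"
    assume bdd: "\<forall>m. \<exists>C. \<forall>t\<ge>1. ?W m (?H t) \<le> C"
      and freq: "\<exists>\<^sub>F t in sequentially. \<Gamma> (?H t) \<and> A t \<omega> = a"
    show "\<exists>\<^sub>F t in sequentially. \<Gamma> (?H t) \<and> A t \<omega> = a \<and> R t \<omega>"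
    proof (rule ccontr)
      assume "\<not> ?thesis"
      then obtain m where m: "\<And>t. m \<le> t \<Longrightarrow> \<Gamma> (?H t) \<Longrightarrow> A t \<omega> = a \<Longrightarrow> \<not> R t \<omega>"
        by (auto simp: not_frequently eventually_sequentially)
      define q where "q = 1 / (1 - \<mu> a)"
      have q: "1 < q"
        using \<mu>[of a] by (simp add: q_def)
      have grow: "?W m (?H (Suc t)) = ?W m (?H t) * (if m \<le> t - 1 \<and> \<Gamma> (?H t) \<and> A t \<omega> = a then q else 1)"
        if "1 \<le> t" for t
      proof -
        have "m \<le> t - 1 \<Longrightarrow> m \<le> t"
          by simp
        then show ?thesis
          using m[of t] by (auto simp: history_Suc[OF that] waiting_weight_snoc q_def)
      qed
      have nonneg: "0 \<le> ?W m h" for h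
        using history_supermartingale_waiting[of \<mu> a \<Gamma> m] \<mu>[of a]
        by (simp add: history_supermartingale_def)
      have mono: "?W m (?H s) \<le> ?W m (?H t)" if "1 \<le> s" "s \<le> t" for s t
        using \<open>s \<le> t\<close>
      proof (induction t rule: dec_induct)
        case (step t)
        have "?W m (?H t) * 1 \<le> ?W m (?H (Suc t))"
          using grow[of t] q nonneg[of "?H t"] step.hyps \<open>1 \<le> s\<close>
          by (auto intro!: mult_left_mono simp del: mult_1_right)
        then show ?case using step.IH by simp
      qed simp
      have large: "\<exists>t\<ge>1. q ^ n \<le> ?W m (?H t)" for n
      proof (induction n)
        case 0
        show ?case by (intro exI[of _ 1]) (simp add: history_def)
      next
        case (Suc n)
        then obtain s where s: "1 \<le> s" "q ^ n \<le> ?W m (?H s)"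
          by blast
        obtain t where t: "Suc m \<le> t" "s \<le> t" "\<Gamma> (?H t)" "A t \<omega> = a"
          using frequently_ex[OF frequently_eventually_frequently[OF freq
            eventually_conj[OF eventually_ge_at_top[of "Suc m"] eventually_ge_at_top[of s]]]] by auto
        have "q * q ^ n \<le> q * ?W m (?H t)"
          using s mono[OF s(1) t(2)] q by (intro mult_left_mono) auto
        also have "\<dots> = ?W m (?H (Suc t))"
          using t grow[of t] by simp
        finally show ?case by (intro exI[of _ "Suc t"]) simp
      qed
      from bdd obtain C where C: "\<And>t. 1 \<le> t \<Longrightarrow> ?W m (?H t) \<le> C"
        by blast
      obtain n where "C < q ^ n"
        using real_arch_pow[OF q] by blast
      then show False
        using large[of n] C by fastforce
    qed
  qed
qed

end

section \<open>Runs of arm 2 and the sliding regret\<close>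

lemma sliding_regret_eq_max:
  assumes "\<mu> Arm2 \<le> \<mu> Arm1" and freq: "\<exists>\<^sub>F t in sequentially. \<forall>i\<in>{1..T}. \<alpha> (t + i) = Arm2"
  shows "sliding_regret \<mu> T \<alpha> = ereal (real T * (\<mu> Arm1 - \<mu> Arm2))"
proof (rule antisym)
  \<comment> \<open>Arm 2 is the worse arm, so no window has a larger regret than one filled with
    it.\<close>
  have ge: "\<mu> Arm2 \<le> \<mu> a" for a
    using assms by (cases a) auto
  have "real T * \<mu> Arm2 \<le> (\<Sum>i = 1..T. \<mu> (\<alpha> (t + i)))" for t
    using sum_mono[of "{1..T}" "\<lambda>_. \<mu> Arm2" "\<lambda>i. \<mu> (\<alpha> (t + i))"] ge by simp
  then show "sliding_regret \<mu> T \<alpha> \<le> ereal (real T * (\<mu> Arm1 - \<mu> Arm2))"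
    unfolding sliding_regret_def
    by (intro Limsup_bounded always_eventually) (simp add: right_diff_distrib)
  show "ereal (real T * (\<mu> Arm1 - \<mu> Arm2)) \<le> sliding_regret \<mu> T \<alpha>"
  proof (rule ccontr)
    assume "\<not> ?thesis"
    then have "\<forall>\<^sub>F t in sequentially. ereal (real T * \<mu> Arm1 - (\<Sum>i = 1..T. \<mu> (\<alpha> (t + i))))
        < ereal (real T * (\<mu> Arm1 - \<mu> Arm2))"
      unfolding sliding_regret_def by (intro Limsup_lessD) (simp add: not_le)
    from frequently_ex[OF frequently_eventually_frequently[OF freq this]]
    obtain t where "\<forall>i\<in>{1..T}. \<alpha> (t + i) = Arm2"
      and "ereal (real T * \<mu> Arm1 - (\<Sum>i = 1..T. \<mu> (\<alpha> (t + i)))) < ereal (real T * (\<mu> Arm1 - \<mu> Arm2))"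
      by blast
    then show False
      by (simp add: right_diff_distrib)
  qed
qed

text \<open>A predicate on histories, so that it can serve as \<open>\<Gamma>\<close> in
  \<open>AE_frequently_rewarded\<close>.\<close>

definition ends_in_run :: "nat \<Rightarrow> hist \<Rightarrow> bool" where
  "ends_in_run j h \<longleftrightarrow> (\<exists>h'. h = h' @ replicate j (Arm2, True))"

lemma ends_in_run_Suc: "ends_in_run j h \<Longrightarrow> ends_in_run (Suc j) (h @ [(Arm2, True)])"
  by (auto simp: ends_in_run_def replicate_append_same)

text \<open>The history at time \<open>t\<close> ends with time \<open>t - 1\<close>, so the run
  occupies the times from \<open>t - j\<close> to \<open>t - 1\<close>. The subtraction does not
  truncate because the run fits into the history.\<close>

lemma arms_of_ends_in_run:
  assumes "ends_in_run j (history A R t \<omega>)" and "i \<in> {1..j}"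
  shows "A (t - 1 - j + i) \<omega> = Arm2"
proof -
  obtain h' where h': "history A R t \<omega> = h' @ replicate j (Arm2, True)"
    using assms by (auto simp: ends_in_run_def)
  from arg_cong[OF this, of length] have len: "t - 1 = length h' + j"
    by simp
  obtain k where i: "i = Suc k" "k < j"
    using assms(2) by (cases i) auto
  have "history A R t \<omega> ! (length h' + k) = (Arm2, True)"
    using i unfolding h' by (simp add: nth_append)
  moreover have "history A R t \<omega> ! (length h' + k) = (A (length h' + i) \<omega>, R (length h' + i) \<omega>)"
    using i len by (simp add: history_def)
  ultimately show ?thesis
    using len by simp
qed

text \<open>The conjunct \<open>A t \<omega> = Arm2\<close> carries the induction: it gives another
  chance of a reward, and a reward both lengthens the run and forces the next pull.\<close>

lemma frequently_run:
  fixes A R \<omega>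
  assumes arm: "\<exists>\<^sub>F t in sequentially. A t \<omega> = Arm2"
    and repeats: "\<forall>\<^sub>F t in sequentially. A t \<omega> = Arm2 \<longrightarrow> R t \<omega> \<longrightarrow> A (Suc t) \<omega> = Arm2"
    and rewarded: "\<And>j. \<exists>\<^sub>F t in sequentially. ends_in_run j (history A R t \<omega>) \<and> A t \<omega> = Arm2 \<Longrightarrow>
      \<exists>\<^sub>F t in sequentially. ends_in_run j (history A R t \<omega>) \<and> A t \<omega> = Arm2 \<and> R t \<omega>"
  shows "\<exists>\<^sub>F t in sequentially. ends_in_run j (history A R t \<omega>) \<and> A t \<omega> = Arm2"
proof (induction j)
  case 0
  then show ?case using arm by (simp add: ends_in_run_def)
next
  case (Suc j)
  have "\<exists>\<^sub>F t in sequentially. ends_in_run (Suc j) (history A R (Suc t) \<omega>) \<and> A (Suc t) \<omega> = Arm2"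
    using frequently_eventually_frequently[OF rewarded[OF Suc]
        eventually_conj[OF repeats eventually_ge_at_top[of 1]]]
    by (rule frequently_elim1) (auto simp: history_Suc intro: ends_in_run_Suc)
  then show ?case
    unfolding frequently_def by (subst (asm) eventually_sequentially_Suc)
qed

theorem theorem8:
  fixes M :: "'a measure" and S :: "'u measure" and U :: "'a \<Rightarrow> 'u"
    and \<mu> :: "arm \<Rightarrow> real" and \<pi> :: "'u policy"
    and A :: "nat \<Rightarrow> 'a \<Rightarrow> arm" and R :: "nat \<Rightarrow> 'a \<Rightarrow> bool" and T :: nat
  assumes "two_armed_bandit M S U \<mu> \<pi> A R"
    and "is_ucb S \<pi>"
    and "0 < \<mu> Arm2" and "\<mu> Arm2 < \<mu> Arm1" and "\<mu> Arm1 < 1"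
    and "T \<ge> 1"
  shows "AE \<omega> in M. sliding_regret \<mu> T (\<lambda>t. A t \<omega>) = ereal (real T * (\<mu> Arm1 - \<mu> Arm2))"
proof -
  interpret two_armed_bandit M S U \<mu> \<pi> A R by fact
  have \<mu>: "0 < \<mu> a \<and> \<mu> a < 1" for a
    using assms by (cases a) auto
  then have \<mu>': "0 \<le> \<mu> a \<and> \<mu> a \<le> 1" for a
    by (simp add: less_imp_le)
  \<comment> \<open>Half the gap separates the two empirical means; half the distance from
    \<open>\<mu> Arm1\<close> to 1, called \<delta>, keeps that of arm 1 away from 1.\<close>
  define \<epsilon> where "\<epsilon> = (\<mu> Arm1 - \<mu> Arm2) / 2"
  define \<delta> where "\<delta> = (1 - \<mu> Arm1) / 2"
  have "0 < \<epsilon>" "0 < \<delta>"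
    using assms by (auto simp: \<epsilon>_def \<delta>_def)
  then have nz: "\<epsilon> \<noteq> 0" "- \<epsilon> \<noteq> 0" "\<delta> \<noteq> 0"
    by auto
  note mean = AE_eventually_emp_mean[OF \<mu>']
  have "AE \<omega> in M. \<forall>j. (\<exists>\<^sub>F t in sequentially. ends_in_run j (history A R t \<omega>) \<and> A t \<omega> = Arm2) \<longrightarrow>
      (\<exists>\<^sub>F t in sequentially. ends_in_run j (history A R t \<omega>) \<and> A t \<omega> = Arm2 \<and> R t \<omega>)"
    unfolding AE_all_countable using AE_frequently_rewarded[OF \<mu>] by blast
  then show ?thesis
    using mean[OF nz(1), of Arm2] mean[OF nz(2), of Arm1] mean[OF nz(3), of Arm1] AE_space
  proof eventually_elim
    case (elim \<omega>)
    let ?H = "\<lambda>t. history A R t \<omega>"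
    have "U \<omega> \<in> space S"
      using measurable_space[OF seed_measurable] elim by blast
    then have ucb: "ucb_index (?H t) a \<le> ucb_index (?H t) (A t \<omega>)" if "1 \<le> t" for t a
      using arm_choice[OF that] elim \<open>is_ucb S \<pi>\<close> by (simp add: is_ucb_def)
    have freq: "\<exists>\<^sub>F t in sequentially. A t \<omega> = a" for a
      by (rule ucb_frequently_pulls[where R = R]) (rule ucb)
    have e1: "\<forall>\<^sub>F t in sequentially. emp_mean (?H t) Arm2 < \<mu> Arm2 + \<epsilon>"
      using elim(2) freq \<open>0 < \<epsilon>\<close> by (auto simp: power2_eq_square elim!: eventually_mono)
    have e2: "\<forall>\<^sub>F t in sequentially. \<mu> Arm1 - \<epsilon> < emp_mean (?H t) Arm1"
    proof -
      have "\<forall>\<^sub>F t in sequentially. \<epsilon> * (\<mu> Arm1 - emp_mean (?H t) Arm1) < \<epsilon> * \<epsilon>"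
        using elim(3) freq \<open>0 < \<epsilon>\<close> by (simp add: power2_eq_square algebra_simps)
      then show ?thesis
        using \<open>0 < \<epsilon>\<close> by (auto elim!: eventually_mono)
    qed
    have "\<forall>\<^sub>F t in sequentially. emp_mean (?H t) Arm2 < emp_mean (?H t) Arm1"
      using e1 e2 by eventually_elim (simp add: \<epsilon>_def field_simps)
    moreover have "\<forall>\<^sub>F t in sequentially. emp_mean (?H t) Arm1 < \<mu> Arm1 + \<delta>"
      using elim(4) freq \<open>0 < \<delta>\<close> by (auto simp: power2_eq_square elim!: eventually_mono)
    moreover have "\<mu> Arm1 + \<delta> < 1"
      using assms by (simp add: \<delta>_def field_simps)
    ultimately have "\<forall>\<^sub>F t in sequentially. A t \<omega> = Arm2 \<longrightarrow> R t \<omega> \<longrightarrow> A (Suc t) \<omega> = Arm2"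
      using ucb by (intro ucb_repeats_rewarded_arm)
    then have "\<exists>\<^sub>F t in sequentially. ends_in_run T (?H t) \<and> A t \<omega> = Arm2"
      using elim(1) freq by (intro frequently_run) auto
    then have run: "\<exists>\<^sub>F t in sequentially. \<forall>i\<in>{1..T}. A (t - 1 - T + i) \<omega> = Arm2"
      by (rule frequently_elim1) (blast intro: arms_of_ends_in_run)
    \<comment> \<open>The shifted index \<open>t - 1 - T\<close> tends to infinity, so a property
      failing eventually would also fail eventually along it.\<close>
    have "\<exists>\<^sub>F t in sequentially. \<forall>i\<in>{1..T}. A (t + i) \<omega> = Arm2"
    proof (rule ccontr)
      assume "\<not> ?thesis"
      then have "\<forall>\<^sub>F t in sequentially. \<not> (\<forall>i\<in>{1..T}. A (t - 1 - T + i) \<omega> = Arm2)"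
        unfolding not_frequently
        using filterlim_minus_const_nat_at_top[of "1 + T"]
        by (auto simp: filterlim_iff)
      with run show False
        by (simp add: frequently_def)
    qed
    then show ?case
      using assms by (intro sliding_regret_eq_max) auto
  qed
qed

end
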